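(* Let $n\ge1$, $w\in\mathbb{R}^n_{>0}$, and fix $1/2\le\beta<1$ and $0<q\le1$. The comparison rule with parameters $(\beta,q)$ retains the target (i.e. $x^*\in\mathcal{B}(c_k,r_k)$ for all $k$) and converges ($c_k\to x^*$) from every initial box $B_0=\mathcal{B}(c_0,r_0w)$ ($c_0\in\mathbb{R}^n$, $r_0>0$) with $x^*\in B_0$, for every $f\in\mathcal{C}(x^*,B_0)$ and every tie rule, if and only if $$q\le2\beta-1 .$$ Under this condition $M_k\le R_k=\beta^kr_0$ for all $k$. In particular, for the coupled rule $q=1-\beta$ this universal property holds if and only if $\beta\ge2/3$, and then it uses $n\lceil\log(r_0/\varepsilon)/\log(1/\beta)\rceil$ binary comparisons to achieve $M_k\le\varepsilon$, for $0<\varepsilon<r_0$.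
   Context: $\mathcal{B}(c,r)=\{x:|x_i-c_i|\le r_i\ \forall i\}$; $\|u\|_{\infty,w}=\max_i|u_i|/w_i$; $R_k=\beta^kr_0$, $r_k=R_kw$, $M_k=\|c_k-x^*\|_{\infty,w}$. Binary order oracle: $\operatorname{cmp}(a,b)=+1$ if $f(a)>f(b)$, $-1$ if $f(a)<f(b)$; if $f(a)=f(b)$ either answer in $\{-1,+1\}$ is admissible (chosen by a tie rule). Comparison rule with parameters $(\beta,q)$: at step $k$, for every coordinate $i$, with $e_i$ the $i$-th unit vector, $$s_{k,i}=\operatorname{cmp}\bigl(c_k+q r_{k,i}e_i,\ c_k-q r_{k,i}e_i\bigr),\qquad c_{k+1,i}=c_{k,i}-(1-\beta)r_{k,i}s_{k,i}.$$ One iteration costs $n$ binary comparisons. Class $\mathcal{C}(x^*,B)$ (common-target monotone sections), for $x^*\in B$: functions $f:B\to\mathbb{R}$ (no continuity assumed) such that for every $i$ and every fixed choice $x_{-i}$ of the other coordinates, whenever the points belong to $B$: $a<b\le x_i^*$ implies $f(x_{-i},a)>f(x_{-i},b)$, and $x_i^*\le a<b$ implies $f(x_{-i},a)<f(x_{-i},b)$. *)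

theory Defs
  imports "HOL-Analysis.Analysis"
begin

definition rbox :: "real^'n \<Rightarrow> real^'n \<Rightarrow> (real^'n) set" where
  "rbox c r = {x. \<forall>i. \<bar>x $ i - c $ i\<bar> \<le> r $ i}"

definition wnorm :: "real^'n \<Rightarrow> real^'n \<Rightarrow> real" where
  "wnorm w u = Max (range (\<lambda>i. \<bar>u $ i\<bar> / w $ i))"

definition upd_coord :: "real^'n \<Rightarrow> 'n \<Rightarrow> real \<Rightarrow> real^'n" where
  "upd_coord x i a = (\<chi> j. if j = i then a else x $ j)"

text \<open>
  Functions on \<open>B\<close> with common-target monotone sections. Members are total functions, but only
  their values on \<open>B\<close> are constrained. All points at which the comparison rule below
  evaluates \<open>f\<close> lie in the initial box when \<open>0 < q \<le> 1\<close> and \<open>0 < \<beta> < 1\<close>, so the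
  values outside of \<open>B\<close> are irrelevant.
\<close>

definition monotone_sections :: "real^'n \<Rightarrow> (real^'n) set \<Rightarrow> (real^'n \<Rightarrow> real) set" where
  "monotone_sections xs B =
     {f. \<forall>i x a b. upd_coord x i a \<in> B \<longrightarrow> upd_coord x i b \<in> B \<longrightarrow>
           (a < b \<and> b \<le> xs $ i \<longrightarrow> f (upd_coord x i a) > f (upd_coord x i b)) \<and>
           (xs $ i \<le> a \<and> a < b \<longrightarrow> f (upd_coord x i a) < f (upd_coord x i b))}"

text \<open>
  A tie rule chooses the answer to a query \<open>(a, b)\<close> with \<open>f a = f b\<close>; the choice may depend on the
  step, the coordinate and the two points. As a run is determined by its inputs and the answers
  received, this also covers choices that depend on the history of the run.
\<close>

type_synonym 'n tie = "nat \<Rightarrow> 'n \<Rightarrow> real^'n \<Rightarrow> real^'n \<Rightarrow> real"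

definition tie_rule :: "'n tie \<Rightarrow> bool" where
  "tie_rule t \<longleftrightarrow> (\<forall>k i a b. t k i a b \<in> {-1, 1})"

definition cmp :: "(real^'n \<Rightarrow> real) \<Rightarrow> (real^'n \<Rightarrow> real^'n \<Rightarrow> real) \<Rightarrow> real^'n \<Rightarrow> real^'n \<Rightarrow> real"
  where "cmp f t a b = (if f a > f b then 1 else if f a < f b then -1 else t a b)"

definition radius :: "real \<Rightarrow> real \<Rightarrow> nat \<Rightarrow> real" where
  "radius \<beta> r0 k = \<beta> ^ k * r0"

definition radii :: "real \<Rightarrow> real^'n \<Rightarrow> real \<Rightarrow> nat \<Rightarrow> real^'n" where
  "radii \<beta> w r0 k = radius \<beta> r0 k *\<^sub>R w"

definition probe_plus :: "real \<Rightarrow> real^'n \<Rightarrow> real^'n \<Rightarrow> 'n \<Rightarrow> real^'n" where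
  "probe_plus q c r i = c + (q * r $ i) *\<^sub>R axis i 1"

definition probe_minus :: "real \<Rightarrow> real^'n \<Rightarrow> real^'n \<Rightarrow> 'n \<Rightarrow> real^'n" where
  "probe_minus q c r i = c - (q * r $ i) *\<^sub>R axis i 1"

primrec center ::
  "real \<Rightarrow> real \<Rightarrow> real^'n \<Rightarrow> (real^'n \<Rightarrow> real) \<Rightarrow> 'n tie \<Rightarrow> real^'n \<Rightarrow> real \<Rightarrow> nat \<Rightarrow> real^'n"
where
  "center \<beta> q w f t c0 r0 0 = c0"
| "center \<beta> q w f t c0 r0 (Suc k) =
     (let c = center \<beta> q w f t c0 r0 k; r = radii \<beta> w r0 k in
      \<chi> i. c $ i - (1 - \<beta>) * r $ i * cmp f (t k i) (probe_plus q c r i) (probe_minus q c r i))"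

text \<open>
  The oracle calls of the first \<open>k\<close> iterations. They are labelled with step and coordinate, so that
  repeated queries of the same pair of points are counted separately.
\<close>

definition oracle_calls ::
  "real \<Rightarrow> real \<Rightarrow> real^'n \<Rightarrow> (real^'n \<Rightarrow> real) \<Rightarrow> 'n tie \<Rightarrow> real^'n \<Rightarrow> real \<Rightarrow> nat
    \<Rightarrow> (nat \<times> 'n \<times> (real^'n) \<times> (real^'n)) set"
where
  "oracle_calls \<beta> q w f t c0 r0 k =
     {(j, i, probe_plus q (center \<beta> q w f t c0 r0 j) (radii \<beta> w r0 j) i,
             probe_minus q (center \<beta> q w f t c0 r0 j) (radii \<beta> w r0 j) i) | j i. j < k}"

definition admissible_instance ::
  "real^'n \<Rightarrow> real^'n \<Rightarrow> real^'n \<Rightarrow> real \<Rightarrow> (real^'n \<Rightarrow> real) \<Rightarrow> 'n tie \<Rightarrow> bool"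
where
  "admissible_instance w xs c0 r0 f t \<longleftrightarrow>
     r0 > 0 \<and> xs \<in> rbox c0 (r0 *\<^sub>R w) \<and>
     f \<in> monotone_sections xs (rbox c0 (r0 *\<^sub>R w)) \<and> tie_rule t"

definition retains_and_converges :: "real \<Rightarrow> real \<Rightarrow> real^'n \<Rightarrow> real^'n \<Rightarrow> bool" where
  "retains_and_converges \<beta> q w xs \<longleftrightarrow>
     (\<forall>c0 r0 f t. admissible_instance w xs c0 r0 f t \<longrightarrow>
        (\<forall>k. xs \<in> rbox (center \<beta> q w f t c0 r0 k) (radii \<beta> w r0 k)) \<and>
        center \<beta> q w f t c0 r0 \<longlonglongrightarrow> xs)"

end

theory Submission imports Defs begin

text \<open>
  One iteration treats the coordinates separately, so everything rests on a one-dimensional fact.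
  Let \<open>d\<close> be the signed distance from the current centre coordinate to the target coordinate and
  \<open>r\<close> the current radius. The two probes sit at \<open>q * r\<close> and \<open>- q * r\<close>. If the target is at or
  beyond one of the probes, both probes lie on one monotone branch of the section and the answer is
  forced; if it lies strictly between them, either answer can occur. So the answer \<open>1\<close> guarantees
  \<open>d \<le> q * r\<close>, the answer \<open>-1\<close> guarantees \<open>- q * r \<le> d\<close>, and neither bound can be improved. The
  centre then moves by \<open>(1 - \<beta>) * r\<close> against the answer. After the answer \<open>1\<close> this turns the
  interval \<open>{- r .. q * r}\<close> for \<open>d\<close> into \<open>{- \<beta> * r .. (q + 1 - \<beta>) * r}\<close>, and the answer \<open>-1\<close>
  gives the mirror image. This fits into the next interval, of radius \<open>\<beta> * r\<close>, if and only if
  \<open>q \<le> 2 * \<beta> - 1\<close>.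

  Hence under this condition the target is retained (\<open>center_retains_target\<close>), and the geometric
  decay of the radii yields convergence and the iteration count. If the condition fails, there is
  room for a relative offset \<open>\<delta>\<close> with \<open>2 * \<beta> - 1 < \<delta> < q\<close>, and a function that rises much more
  steeply above the target than it does below it makes the first step move away from the target and
  lose it (\<open>retention_imp_probe_bound\<close>).
\<close>

section \<open>The comparison step\<close>

lemma mem_rbox_iff: "x \<in> rbox c r \<longleftrightarrow> (\<forall>i. \<bar>x $ i - c $ i\<bar> \<le> r $ i)"
  by (simp add: rbox_def)

lemma upd_coord_nth [simp]: "upd_coord x i a $ j = (if j = i then a else x $ j)"
  by (simp add: upd_coord_def)

lemma probe_plus_eq_upd_coord: "probe_plus q c r i = upd_coord c i (c $ i + q * r $ i)"
  by (simp add: vec_eq_iff probe_plus_def axis_def)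

lemma probe_minus_eq_upd_coord: "probe_minus q c r i = upd_coord c i (c $ i - q * r $ i)"
  by (simp add: vec_eq_iff probe_minus_def axis_def)

lemma radii_nth: "radii \<beta> w r0 k $ i = \<beta> ^ k * r0 * w $ i"
  by (simp add: radii_def radius_def)

lemma center_Suc_nth:
  "center \<beta> q w f t c0 r0 (Suc k) $ i =
     center \<beta> q w f t c0 r0 k $ i - (1 - \<beta>) * radii \<beta> w r0 k $ i *
       cmp f (t k i) (probe_plus q (center \<beta> q w f t c0 r0 k) (radii \<beta> w r0 k) i)
                     (probe_minus q (center \<beta> q w f t c0 r0 k) (radii \<beta> w r0 k) i)"
  by (simp add: Let_def)

lemma cmp_cases:
  assumes "tie_rule t"
  shows "cmp f (t k i) a b = 1 \<or> cmp f (t k i) a b = -1"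
  using assms by (auto simp: cmp_def tie_rule_def)

lemma monotone_sections_decreasing:
  assumes "f \<in> monotone_sections xs B" "upd_coord x i a \<in> B" "upd_coord x i b \<in> B"
    and "a < b" "b \<le> xs $ i"
  shows "f (upd_coord x i b) < f (upd_coord x i a)"
  using assms by (auto simp: monotone_sections_def)

lemma monotone_sections_increasing:
  assumes "f \<in> monotone_sections xs B" "upd_coord x i a \<in> B" "upd_coord x i b \<in> B"
    and "xs $ i \<le> a" "a < b"
  shows "f (upd_coord x i a) < f (upd_coord x i b)"
  using assms by (auto simp: monotone_sections_def)

text \<open>
  A comparison localises the target coordinate: an answer excludes the targets for which both
  probes would lie on the branch that enforces the opposite answer.
\<close>

lemma cmp_localises_target:
  assumes f: "f \<in> monotone_sections xs B"
    and B: "upd_coord c i (c $ i + h) \<in> B" "upd_coord c i (c $ i - h) \<in> B"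
    and h: "0 < h"
    and s: "s = cmp f t (upd_coord c i (c $ i + h)) (upd_coord c i (c $ i - h))"
  shows "s = 1 \<Longrightarrow> xs $ i - c $ i \<le> h" and "s = -1 \<Longrightarrow> - h \<le> xs $ i - c $ i"
proof -
  show "xs $ i - c $ i \<le> h" if "s = 1"
  proof (rule ccontr)
    assume "\<not> ?thesis"
    then have "f (upd_coord c i (c $ i + h)) < f (upd_coord c i (c $ i - h))"
      using monotone_sections_decreasing[OF f B(2,1)] h by simp
    then show False using s that by (simp add: cmp_def)
  qed
  show "- h \<le> xs $ i - c $ i" if "s = -1"
  proof (rule ccontr)
    assume "\<not> ?thesis"
    then have "f (upd_coord c i (c $ i - h)) < f (upd_coord c i (c $ i + h))"
      using monotone_sections_increasing[OF f B(2,1)] h by simp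
    then show False using s that by (simp add: cmp_def)
  qed
qed

text \<open>
  The steps form a geometric series, so the boxes around the centres stay nested in the initial
  one. Every probe is therefore a point at which the monotonicity of the sections is available.
\<close>

lemma center_near_start:
  assumes t: "tie_rule t" and \<beta>: "0 \<le> \<beta>" "\<beta> \<le> 1" and r0: "0 \<le> r0" and w: "0 \<le> w $ i"
  shows "\<bar>center \<beta> q w f t c0 r0 k $ i - c0 $ i\<bar> \<le> (1 - \<beta> ^ k) * r0 * w $ i"
proof (induction k)
  case 0
  show ?case by simp
next
  case (Suc k)
  let ?step = "(1 - \<beta>) * (\<beta> ^ k * r0 * w $ i)"
  have "0 \<le> ?step" using \<beta> r0 w by simp
  then have "\<bar>center \<beta> q w f t c0 r0 (Suc k) $ i - center \<beta> q w f t c0 r0 k $ i\<bar> \<le> ?step"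
    unfolding center_Suc_nth radii_nth
    using cmp_cases[OF t, of f k i
        "probe_plus q (center \<beta> q w f t c0 r0 k) (radii \<beta> w r0 k) i"
        "probe_minus q (center \<beta> q w f t c0 r0 k) (radii \<beta> w r0 k) i"] by auto
  then have "\<bar>center \<beta> q w f t c0 r0 (Suc k) $ i - c0 $ i\<bar>
               \<le> (1 - \<beta> ^ k) * r0 * w $ i + ?step"
    using Suc.IH by linarith
  also have "\<dots> = (1 - \<beta> ^ Suc k) * r0 * w $ i" by (simp add: algebra_simps)
  finally show ?case .
qed

lemma probe_mem_initial_box:
  fixes w c0 :: "real^'n" and f and q
  assumes t: "tie_rule t" and \<beta>: "0 \<le> \<beta>" "\<beta> \<le> 1" and r0: "0 \<le> r0"
    and w: "\<And>j. 0 \<le> w $ j" and h: "\<bar>h\<bar> \<le> \<beta> ^ k * r0 * w $ i"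
  defines "c \<equiv> center \<beta> q w f t c0 r0 k"
  shows "upd_coord c i (c $ i + h) \<in> rbox c0 (r0 *\<^sub>R w)"
proof -
  have near: "\<bar>c $ j - c0 $ j\<bar> \<le> r0 * w $ j - \<beta> ^ k * r0 * w $ j" for j
    using center_near_start[where i = j, OF t \<beta> r0 w, where f = f and q = q and k = k and ?c0.0 = c0]
    by (simp add: c_def algebra_simps)
  have "0 \<le> \<beta> ^ k * r0 * w $ j" for j using \<beta> r0 w by simp
  then have "\<bar>c $ j - c0 $ j\<bar> \<le> r0 * w $ j" for j
    using near[of j] by (smt (verit))
  moreover have "\<bar>c $ i + h - c0 $ i\<bar> \<le> r0 * w $ i"
    using near[of i] h by linarith
  ultimately show ?thesis by (auto simp: mem_rbox_iff)
qed

section \<open>Sufficiency\<close>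

text \<open>
  The condition on \<open>q\<close> is what makes the far end \<open>(q + 1 - \<beta>) * r\<close> of the shifted interval fit
  into the next radius \<open>\<beta> * r\<close>; the other end, \<open>\<beta> * r\<close> away, fits for every \<open>q\<close>.
\<close>

lemma center_retains_target:
  assumes w: "\<And>i. 0 < w $ i" and \<beta>: "0 < \<beta>" "\<beta> < 1" and q: "0 < q" "q \<le> 2 * \<beta> - 1"
    and inst: "admissible_instance w xs c0 r0 f t"
  shows "\<bar>xs $ i - center \<beta> q w f t c0 r0 k $ i\<bar> \<le> \<beta> ^ k * r0 * w $ i"
proof (induction k)
  case 0
  show ?case using inst by (simp add: admissible_instance_def mem_rbox_iff)
next
  case (Suc k)
  have r0: "r0 > 0" and f: "f \<in> monotone_sections xs (rbox c0 (r0 *\<^sub>R w))" and t: "tie_rule t"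
    using inst by (auto simp: admissible_instance_def)
  define c where "c = center \<beta> q w f t c0 r0 k"
  define r where "r = \<beta> ^ k * r0 * w $ i"
  define s where "s = cmp f (t k i) (upd_coord c i (c $ i + q * r)) (upd_coord c i (c $ i - q * r))"
  have r: "0 < r" using w \<beta> r0 by (simp add: r_def)
  have "q * r \<le> 1 * r" by (rule mult_right_mono) (use q \<beta> r in linarith)+
  then have qr: "0 < q * r" "q * r \<le> r" using q r by auto
  have B: "upd_coord c i (c $ i + q * r) \<in> rbox c0 (r0 *\<^sub>R w)"
          "upd_coord c i (c $ i - q * r) \<in> rbox c0 (r0 *\<^sub>R w)"
    using probe_mem_initial_box[of t \<beta> r0 w "q * r" k i q f c0]
      probe_mem_initial_box[of t \<beta> r0 w "- (q * r)" k i q f c0]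
      t \<beta> r0 w qr by (simp_all add: c_def r_def less_imp_le)
  note localised = cmp_localises_target[OF f B qr(1) s_def]
  have next_center: "center \<beta> q w f t c0 r0 (Suc k) $ i = c $ i - (1 - \<beta>) * r * s"
    unfolding center_Suc_nth probe_plus_eq_upd_coord probe_minus_eq_upd_coord radii_nth
    by (simp add: c_def r_def s_def)
  have fits: "q * r + (1 - \<beta>) * r \<le> \<beta> * r"
    using mult_right_mono[OF q(2), of r] r by (simp add: algebra_simps)
  have IH: "\<bar>xs $ i - c $ i\<bar> \<le> r" using Suc.IH by (simp add: c_def r_def)
  have split: "(1 - \<beta>) * r = r - \<beta> * r" by (simp add: algebra_simps)
  from cmp_cases[OF t] have "s = 1 \<or> s = -1" unfolding s_def .
  then have "\<bar>xs $ i - (c $ i - (1 - \<beta>) * r * s)\<bar> \<le> \<beta> * r"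
  proof
    assume "s = 1"
    with localised(1) IH fits split show ?thesis by (simp add: abs_le_iff)
  next
    assume "s = -1"
    with localised(2) IH fits split show ?thesis by (simp add: abs_le_iff)
  qed
  then show ?case unfolding next_center by (simp add: r_def mult.assoc)
qed

lemma wnorm_le:
  assumes "\<And>i. 0 < w $ i" "\<And>i. \<bar>u $ i\<bar> \<le> R * w $ i"
  shows "wnorm w u \<le> R"
  unfolding wnorm_def using assms by (auto intro!: Max.boundedI simp: divide_le_eq)

lemma wnorm_center_le_radius:
  assumes "\<And>i. 0 < w $ i" "0 < \<beta>" "\<beta> < 1" "0 < q" "q \<le> 2 * \<beta> - 1"
    and "admissible_instance w xs c0 r0 f t"
  shows "wnorm w (center \<beta> q w f t c0 r0 k - xs) \<le> radius \<beta> r0 k"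
  using center_retains_target[OF assms] assms(1)
  by (intro wnorm_le) (simp_all add: radius_def abs_minus_commute)

lemma probe_bound_imp_retains_and_converges:
  assumes "\<And>i. 0 < w $ i" "0 < \<beta>" "\<beta> < 1" "0 < q" "q \<le> 2 * \<beta> - 1"
  shows "retains_and_converges \<beta> q w xs"
  unfolding retains_and_converges_def
proof (intro allI impI conjI)
  fix c0 r0 f t
  assume inst: "admissible_instance w xs c0 r0 f t"
  note bound = center_retains_target[OF assms inst]
  show "xs \<in> rbox (center \<beta> q w f t c0 r0 k) (radii \<beta> w r0 k)" for k
    using bound by (simp add: mem_rbox_iff radii_nth)
  show "center \<beta> q w f t c0 r0 \<longlonglongrightarrow> xs"
  proof (rule vec_tendstoI)
    fix i
    have "(\<lambda>k. \<beta> ^ k) \<longlonglongrightarrow> 0" using assms by (intro LIMSEQ_realpow_zero) auto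
    then have "(\<lambda>k. \<beta> ^ k * r0 * w $ i) \<longlonglongrightarrow> 0"
      by (intro tendsto_mult_left_zero)
    then have "(\<lambda>k. center \<beta> q w f t c0 r0 k $ i - xs $ i) \<longlonglongrightarrow> 0"
      by (rule Lim_null_comparison[rotated])
         (use bound in \<open>simp add: abs_minus_commute\<close>)
    then show "(\<lambda>k. center \<beta> q w f t c0 r0 k $ i) \<longlonglongrightarrow> xs $ i"
      by (simp add: LIM_zero_iff)
  qed
qed

section \<open>Necessity\<close>

text \<open>
  A separable function with slope \<open>- 1\<close> below and slope \<open>K\<close> above the target in every coordinate.
  It is convex and continuous, so such regularity does not help the comparison rule. If \<open>K\<close> is
  large, a probe slightly above the target looks worse than one far below it.
\<close>

definition tilted_distance :: "real^'n \<Rightarrow> real \<Rightarrow> real^'n \<Rightarrow> real" where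
  "tilted_distance xs K x = (\<Sum>j\<in>UNIV. max (xs $ j - x $ j) (K * (x $ j - xs $ j)))"

lemma tilted_distance_upd_coord_less_iff:
  "tilted_distance xs K (upd_coord x i a) < tilted_distance xs K (upd_coord x i b) \<longleftrightarrow>
     max (xs $ i - a) (K * (a - xs $ i)) < max (xs $ i - b) (K * (b - xs $ i))"
  by (simp add: tilted_distance_def sum.remove[of UNIV i])

lemma tilted_distance_in_monotone_sections:
  assumes K: "0 < K"
  shows "tilted_distance xs K \<in> monotone_sections xs B"
proof -
  have below: "max (xs $ i - a) (K * (a - xs $ i)) = xs $ i - a" if "a \<le> xs $ i" for i a
    using mult_nonneg_nonpos[of K "a - xs $ i"] K that by (intro max_absorb1) linarith
  have above: "max (xs $ i - a) (K * (a - xs $ i)) = K * (a - xs $ i)" if "xs $ i \<le> a" for i a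
    using mult_nonneg_nonneg[of K "a - xs $ i"] K that by (intro max_absorb2) linarith
  show ?thesis
    using K by (auto simp: monotone_sections_def tilted_distance_upd_coord_less_iff below above)
qed

text \<open>
  With \<open>r0 = 1\<close> the target is placed at relative offset \<open>\<delta>\<close> above the starting centre. The
  first step moves the centre down by \<open>1 - \<beta>\<close>, so that the offset becomes \<open>\<delta> + 1 - \<beta>\<close>, which
  exceeds the new radius \<open>\<beta>\<close> because \<open>2 * \<beta> - 1 < \<delta>\<close>.
\<close>

lemma retention_imp_probe_bound:
  fixes w xs :: "real^'n"
  assumes w: "\<And>i. 0 < w $ i" and \<beta>: "1/2 \<le> \<beta>" and q: "q \<le> 1"
    and ret: "retains_and_converges \<beta> q w xs"
  shows "q \<le> 2 * \<beta> - 1"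
proof (rule ccontr)
  assume "\<not> ?thesis"
  then obtain \<delta> where \<delta>: "2 * \<beta> - 1 < \<delta>" "\<delta> < q"
    using dense[of "2 * \<beta> - 1" q] by auto
  have \<delta>_range: "0 < \<delta>" "\<delta> < 1" using \<delta> \<beta> q by linarith+
  define K where "K = 2 / (q - \<delta>)"
  have K: "0 < K" "K * (q - \<delta>) = 2"
    using \<delta> nonzero_divide_eq_eq[of "q - \<delta>" 2 K] by (auto simp: K_def)
  define f where "f = tilted_distance xs K"
  define t :: "'n tie" where "t = (\<lambda>_ _ _ _. 1)"
  define c0 where "c0 = xs - \<delta> *\<^sub>R w"
  fix i :: 'n
  have "admissible_instance w xs c0 1 f t"
    using w \<delta>_range tilted_distance_in_monotone_sections[OF K(1), of xs]
    by (simp add: admissible_instance_def f_def t_def tie_rule_def c0_def mem_rbox_iff abs_mult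
        abs_of_pos)
  then have "xs \<in> rbox (center \<beta> q w f t c0 1 (Suc 0)) (radii \<beta> w 1 (Suc 0))"
    using ret unfolding retains_and_converges_def by blast
  then have retained: "\<bar>xs $ i - center \<beta> q w f t c0 1 (Suc 0) $ i\<bar> \<le> \<beta> * w $ i"
    by (auto simp: mem_rbox_iff radii_nth)
  have "f (upd_coord c0 i (c0 $ i - q * w $ i)) < f (upd_coord c0 i (c0 $ i + q * w $ i))"
  proof -
    let ?lo = "c0 $ i - q * w $ i" and ?hi = "c0 $ i + q * w $ i"
    have lo: "xs $ i - ?lo = (q + \<delta>) * w $ i" and hi: "?hi - xs $ i = (q - \<delta>) * w $ i"
      by (simp_all add: c0_def algebra_simps)
    have "(q + \<delta>) * w $ i < 2 * w $ i"
      using \<delta>_range q w by (intro mult_strict_right_mono) linarith+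
    also have "2 * w $ i = K * (?hi - xs $ i)"
      unfolding hi using K(2) by (simp add: mult.assoc[symmetric])
    finally have steep: "xs $ i - ?lo < K * (?hi - xs $ i)" unfolding lo .
    have "0 < (q + \<delta>) * w $ i" using \<delta>_range \<delta> w by simp
    then have "K * (?lo - xs $ i) < 0"
      using K(1) lo by (intro mult_pos_neg) linarith+
    with steep \<open>0 < (q + \<delta>) * w $ i\<close> show ?thesis
      unfolding f_def tilted_distance_upd_coord_less_iff using lo
      by (simp add: less_max_iff_disj)
  qed
  then have "center \<beta> q w f t c0 1 (Suc 0) $ i = c0 $ i - (1 - \<beta>) * w $ i"
    unfolding center_Suc_nth probe_plus_eq_upd_coord probe_minus_eq_upd_coord radii_nth
    by (simp add: cmp_def)
  then have "xs $ i - center \<beta> q w f t c0 1 (Suc 0) $ i = (\<delta> + (1 - \<beta>)) * w $ i"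
    by (simp add: c0_def algebra_simps)
  moreover have "\<beta> * w $ i < (\<delta> + (1 - \<beta>)) * w $ i"
    using \<delta>(1) w by (intro mult_strict_right_mono) linarith+
  ultimately show False using retained by linarith
qed

section \<open>Counting comparisons\<close>

lemma card_oracle_calls:
  fixes w :: "real^'n"
  shows "card (oracle_calls \<beta> q w f t c0 r0 k) = k * CARD('n)"
proof -
  let ?call = "\<lambda>(j, i).
    (j, i, probe_plus q (center \<beta> q w f t c0 r0 j) (radii \<beta> w r0 j) i,
           probe_minus q (center \<beta> q w f t c0 r0 j) (radii \<beta> w r0 j) i)"
  have "oracle_calls \<beta> q w f t c0 r0 k = ?call ` ({..<k} \<times> (UNIV :: 'n set))"
    by (auto simp: oracle_calls_def)
  moreover have "inj_on ?call ({..<k} \<times> (UNIV :: 'n set))"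
    by (auto intro!: inj_onI)
  ultimately show ?thesis by (simp add: card_image card_cartesian_product)
qed

lemma radius_le_of_iterations:
  assumes \<beta>: "0 < \<beta>" "\<beta> < 1" and pos: "0 < r0" "0 < \<epsilon>" and k: "ln (r0 / \<epsilon>) / ln (1 / \<beta>) \<le> real k"
  shows "radius \<beta> r0 k \<le> \<epsilon>"
proof -
  have "0 < ln (1 / \<beta>)" using \<beta> by simp
  then have "ln (r0 / \<epsilon>) \<le> real k * ln (1 / \<beta>)" using k by (simp add: pos_divide_le_eq)
  also have "\<dots> = ln ((1 / \<beta>) ^ k)" using \<beta> by (simp add: ln_realpow)
  finally have "r0 / \<epsilon> \<le> (1 / \<beta>) ^ k" using \<beta> pos by (subst (asm) ln_le_cancel_iff) auto
  then show ?thesis using \<beta> pos by (simp add: radius_def field_simps)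
qed

lemma comparisons_to_accuracy:
  fixes w xs :: "real^'n"
  assumes "\<And>i. 0 < w $ i" and \<beta>: "0 < \<beta>" "\<beta> < 1" and "0 < q" "q \<le> 2 * \<beta> - 1"
    and inst: "admissible_instance w xs c0 r0 f t" and \<epsilon>: "0 < \<epsilon>" "\<epsilon> < r0"
  shows "\<exists>k. int (card (oracle_calls \<beta> q w f t c0 r0 k)) =
               int CARD('n) * \<lceil>ln (r0 / \<epsilon>) / ln (1 / \<beta>)\<rceil> \<and>
             wnorm w (center \<beta> q w f t c0 r0 k - xs) \<le> \<epsilon>"
proof -
  let ?K = "ln (r0 / \<epsilon>) / ln (1 / \<beta>)"
  have "0 \<le> ?K" using \<beta> \<epsilon> by simp
  then have "int (nat \<lceil>?K\<rceil>) = \<lceil>?K\<rceil>" by simp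
  then have "int (card (oracle_calls \<beta> q w f t c0 r0 (nat \<lceil>?K\<rceil>))) = int CARD('n) * \<lceil>?K\<rceil>"
    by (simp only: card_oracle_calls of_nat_mult mult.commute)
  moreover have "radius \<beta> r0 (nat \<lceil>?K\<rceil>) \<le> \<epsilon>"
    using \<beta> \<epsilon> by (intro radius_le_of_iterations real_nat_ceiling_ge) auto
  then have "wnorm w (center \<beta> q w f t c0 r0 (nat \<lceil>?K\<rceil>) - xs) \<le> \<epsilon>"
    using wnorm_center_le_radius[OF assms(1-6)] order_trans by blast
  ultimately show ?thesis by blast
qed

section \<open>The sharp threshold\<close>

lemma retains_and_converges_iff:
  assumes "\<And>i. 0 < w $ i" "1/2 \<le> \<beta>" "\<beta> < 1" "0 < q" "q \<le> 1"
  shows "retains_and_converges \<beta> q w xs \<longleftrightarrow> q \<le> 2 * \<beta> - 1"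
proof
  show "q \<le> 2 * \<beta> - 1" if "retains_and_converges \<beta> q w xs"
    using assms(1,2,5) that by (rule retention_imp_probe_bound)
  show "retains_and_converges \<beta> q w xs" if "q \<le> 2 * \<beta> - 1"
    using assms that by (intro probe_bound_imp_retains_and_converges) auto
qed

theorem theorem5p2:
  fixes w xs :: "real^'n" and \<beta> q :: real
  assumes w_pos: "\<And>i. w $ i > 0"
    and \<beta>: "1/2 \<le> \<beta>" "\<beta> < 1"
    and q: "0 < q" "q \<le> 1"
  shows
    "(retains_and_converges \<beta> q w xs \<longleftrightarrow> q \<le> 2 * \<beta> - 1) \<and>
     (q \<le> 2 * \<beta> - 1 \<longrightarrow>
        (\<forall>c0 r0 f t. admissible_instance w xs c0 r0 f t \<longrightarrow>
           (\<forall>k. wnorm w (center \<beta> q w f t c0 r0 k - xs) \<le> radius \<beta> r0 k))) \<and>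
     (retains_and_converges \<beta> (1 - \<beta>) w xs \<longleftrightarrow> \<beta> \<ge> 2/3) \<and>
     (\<beta> \<ge> 2/3 \<longrightarrow>
        (\<forall>c0 r0 f t \<epsilon>. admissible_instance w xs c0 r0 f t \<longrightarrow> 0 < \<epsilon> \<longrightarrow> \<epsilon> < r0 \<longrightarrow>
           (\<exists>k. int (card (oracle_calls \<beta> (1 - \<beta>) w f t c0 r0 k)) =
                  int CARD('n) * \<lceil>ln (r0 / \<epsilon>) / ln (1 / \<beta>)\<rceil> \<and>
                wnorm w (center \<beta> (1 - \<beta>) w f t c0 r0 k - xs) \<le> \<epsilon>)))"
proof (intro conjI impI allI)
  have \<beta>_pos: "0 < \<beta>" using \<beta> by simp
  show "retains_and_converges \<beta> q w xs \<longleftrightarrow> q \<le> 2 * \<beta> - 1"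
    by (rule retains_and_converges_iff) fact+
  show "wnorm w (center \<beta> q w f t c0 r0 k - xs) \<le> radius \<beta> r0 k"
    if "q \<le> 2 * \<beta> - 1" "admissible_instance w xs c0 r0 f t" for c0 r0 f t k
    by (rule wnorm_center_le_radius) fact+
  have coupled: "1 - \<beta> \<le> 2 * \<beta> - 1 \<longleftrightarrow> 2/3 \<le> \<beta>" by auto
  show "retains_and_converges \<beta> (1 - \<beta>) w xs \<longleftrightarrow> \<beta> \<ge> 2/3"
    using retains_and_converges_iff[OF w_pos \<beta>, of "1 - \<beta>"] \<beta> coupled by simp
  show "\<exists>k. int (card (oracle_calls \<beta> (1 - \<beta>) w f t c0 r0 k)) =
              int CARD('n) * \<lceil>ln (r0 / \<epsilon>) / ln (1 / \<beta>)\<rceil> \<and>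
            wnorm w (center \<beta> (1 - \<beta>) w f t c0 r0 k - xs) \<le> \<epsilon>"
    if "\<beta> \<ge> 2/3" "admissible_instance w xs c0 r0 f t" "0 < \<epsilon>" "\<epsilon> < r0" for c0 r0 f t \<epsilon>
    using that \<beta> coupled w_pos by (intro comparisons_to_accuracy) auto
qed

end
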